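(* Let $F=(f_1,f_2,f_3):\Omega\subset\mathbb R^3\to\mathbb R^3$ be differentiable in the sense of Fréchet over an open set $\Omega$, and let $\mathbb A=\mathbb A^3_{1,2,3}$. Then the components of $F$ satisfy on $\Omega$ the equations $$\frac{\partial f_i}{\partial x_j}=0,\qquad i,j\in\{1,2,3\},\quad i\neq j,$$ if and only if $F$ is $\mathbb A$-algebrizable.
   Context: $\mathbb A^3_{1,2,3}$ denotes $\mathbb R^3$ (canonical basis $e_1,e_2,e_3$) with the product $e_ie_i=e_i$ for $i=1,2,3$ and $e_ie_j=0$ for $i\ne j$; its unit is $e=e_1+e_2+e_3$. $F$ is $\mathbb A$-algebrizable on $\Omega$ if there is a function $F':\Omega\to\mathbb R^3$ with $\lim_{\xi\to0}|F(w+\xi)-F(w)-F'(w)\xi|/|\xi|=0$ for all $w\in\Omega$, where $F'(w)\xi$ is the product in $\mathbb A$. *)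

theory Defs
  imports "HOL-Analysis.Analysis"
begin

definition basis_prod :: "3 \<Rightarrow> 3 \<Rightarrow> real ^ 3" where
  "basis_prod i j = (if i = j then axis i 1 else 0)"

text \<open>The product of the algebra with \<open>e\<^sub>i e\<^sub>i = e\<^sub>i\<close> and \<open>e\<^sub>i e\<^sub>j = 0\<close> for
  \<open>i \<noteq> j\<close>, extended bilinearly from the canonical basis.\<close>

definition A123_mult :: "real ^ 3 \<Rightarrow> real ^ 3 \<Rightarrow> real ^ 3" where
  "A123_mult x y = (\<Sum>i\<in>UNIV. \<Sum>j\<in>UNIV. (x $ i * y $ j) *\<^sub>R basis_prod i j)"

text \<open>It is the componentwise product that the library puts on \<open>real ^ 3\<close>.\<close>

lemma A123_mult_eq_times: "A123_mult x y = x * y"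
  by (simp add: vec_eq_iff A123_mult_def basis_prod_def axis_def forall_3 sum_3)

lemma A123_mult_basis: "A123_mult (axis i 1) (axis j 1) = (if i = j then axis i 1 else 0)"
  by (auto simp: A123_mult_eq_times vec_eq_iff axis_def)

lemma A123_mult_unit:
  "A123_mult (axis 1 1 + axis 2 1 + axis 3 1) x = x"
  "A123_mult x (axis 1 1 + axis 2 1 + axis 3 1) = x"
  by (simp_all add: A123_mult_eq_times vec_eq_iff axis_def forall_3)

lemma bilinear_A123_mult: "bilinear A123_mult"
  by (auto simp: bilinear_def linear_iff A123_mult_eq_times algebra_simps)

text \<open>Only the values of \<open>F\<close> on the open set \<open>\<Omega>\<close> matter here: the limit looks at
  \<open>w + \<xi>\<close> for arbitrarily small \<open>\<xi>\<close> only.\<close>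

definition algebrizable_on ::
  "('a::real_normed_vector \<Rightarrow> 'a \<Rightarrow> 'a) \<Rightarrow> ('a \<Rightarrow> 'a) \<Rightarrow> 'a set \<Rightarrow> bool" where
  "algebrizable_on m F \<Omega> \<longleftrightarrow>
     (\<exists>F'. \<forall>w\<in>\<Omega>.
        ((\<lambda>\<xi>. norm (F (w + \<xi>) - F w - m (F' w) \<xi>) / norm \<xi>) \<longlongrightarrow> 0) (at 0))"

text \<open>The partial derivative with respect to the \<open>j\<close>-th coordinate; meaningful only where it exists,
  as it does for the components of a differentiable map.\<close>

definition partial_deriv :: "'n::finite \<Rightarrow> (real ^ 'n \<Rightarrow> real) \<Rightarrow> real ^ 'n \<Rightarrow> real" where
  "partial_deriv j f x = deriv (\<lambda>t. f (x + t *\<^sub>R axis j 1)) 0"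

end

theory Submission
  imports Defs
begin

text \<open>The algebrizability condition at a point says exactly that multiplication by \<open>F' w\<close> is the
  Frechet derivative of \<open>F\<close> at \<open>w\<close>, because multiplication by a fixed element is a linear map
  (\<open>algebrizable_on_iff_has_derivative\<close>).  The product being componentwise, multiplications by
  elements of the algebra are exactly the linear maps whose matrix is diagonal, the multiplier being
  the diagonal (\<open>linear_eq_A123_mult_iff\<close>).  The matrix of the Frechet derivative is the
  Jacobian matrix (\<open>partial_deriv_component\<close>).  So algebrizability means that the Jacobian matrix is
  diagonal at every point of \<open>\<Omega>\<close>, which is what the system of equations says.\<close>

lemma algebrizable_on_iff_has_derivative:
  assumes "\<And>a. bounded_linear (m a)"
  shows "algebrizable_on m F \<Omega> \<longleftrightarrow> (\<forall>w\<in>\<Omega>. \<exists>a. (F has_derivative m a) (at w))"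
proof -
  have "algebrizable_on m F \<Omega> \<longleftrightarrow> (\<exists>F'. \<forall>w\<in>\<Omega>. (F has_derivative m (F' w)) (at w))"
    by (simp add: algebrizable_on_def has_derivative_at assms)
  also have "\<dots> \<longleftrightarrow> (\<forall>w\<in>\<Omega>. \<exists>a. (F has_derivative m a) (at w))"
    by metis
  finally show ?thesis .
qed

lemma bounded_linear_A123_mult: "bounded_linear (A123_mult a)"
  using bilinear_A123_mult by (simp add: bilinear_def linear_conv_bounded_linear)

lemma linear_eq_A123_mult_iff:
  assumes "linear D"
  shows "(\<exists>a. D = A123_mult a) \<longleftrightarrow> (\<forall>i j. i \<noteq> j \<longrightarrow> D (axis j 1) $ i = 0)"
proof
  assume "\<exists>a. D = A123_mult a"
  then show "\<forall>i j. i \<noteq> j \<longrightarrow> D (axis j 1) $ i = 0"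
    by (auto simp: A123_mult_eq_times axis_def)
next
  assume off: "\<forall>i j. i \<noteq> j \<longrightarrow> D (axis j 1) $ i = 0"
  \<comment> \<open>The multiplier can only be \<open>D e\<close>, the image of the unit, whose coordinates are the
    diagonal entries.\<close>
  define a :: "real ^ 3" where "a = (\<chi> i. D (axis i 1) $ i)"
  have "linear (A123_mult a)"
    by (simp add: bounded_linear_A123_mult bounded_linear.linear)
  with \<open>linear D\<close> have "D = A123_mult a"
  proof (rule linear_eq_stdbasis)
    fix b :: "real ^ 3"
    assume "b \<in> Basis"
    then obtain j where b: "b = axis j 1"
      by (auto simp: Basis_vec_def)
    have "D (axis j 1) $ i = a $ i * axis j 1 $ i" for i
    proof (cases "i = j")
      case True
      then show ?thesis by (simp add: a_def)
    next
      case False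
      then have "D (axis j 1) $ i = 0" using off by blast
      with False show ?thesis by (simp add: axis_def)
    qed
    then show "D b = A123_mult a b"
      by (simp add: vec_eq_iff A123_mult_eq_times b)
  qed
  then show "\<exists>a. D = A123_mult a" ..
qed

lemma partial_deriv_component:
  fixes F :: "real ^ 'n \<Rightarrow> real ^ 'm"
  assumes "(F has_derivative D) (at x)"
  shows "partial_deriv j (\<lambda>y. F y $ i) x = D (axis j 1) $ i"
proof -
  have lin: "linear D"
    using assms by (rule has_derivative_linear)
  have line: "((\<lambda>t. x + t *\<^sub>R axis j 1) has_derivative (\<lambda>t. t *\<^sub>R axis j 1)) (at 0)"
    by (auto intro!: derivative_eq_intros)
  have "((\<lambda>t. F (x + t *\<^sub>R axis j 1)) has_derivative (\<lambda>t. D (t *\<^sub>R axis j 1))) (at 0)"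
    using has_derivative_compose[OF line, of F D] assms by simp
  then have "((\<lambda>t. F (x + t *\<^sub>R axis j 1) $ i) has_derivative
      (\<lambda>t. D (t *\<^sub>R axis j 1) $ i)) (at 0)"
    by (rule bounded_linear.has_derivative[OF bounded_linear_vec_nth])
  then have "((\<lambda>t. F (x + t *\<^sub>R axis j 1) $ i) has_field_derivative D (axis j 1) $ i) (at 0)"
    by (simp add: has_field_derivative_def linear_cmul[OF lin] mult_commute_abs)
  then show ?thesis
    unfolding partial_deriv_def by (rule DERIV_imp_deriv)
qed

theorem theorem2p5:
  fixes F :: "real ^ 3 \<Rightarrow> real ^ 3" and \<Omega> :: "(real ^ 3) set"
  assumes "open \<Omega>" and "F differentiable_on \<Omega>"
  shows "(\<forall>i j. i \<noteq> j \<longrightarrow> (\<forall>x\<in>\<Omega>. partial_deriv j (\<lambda>y. F y $ i) x = 0))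
    \<longleftrightarrow> algebrizable_on A123_mult F \<Omega>"
proof -
  have "(\<forall>i j. i \<noteq> j \<longrightarrow> partial_deriv j (\<lambda>y. F y $ i) x = 0)
      \<longleftrightarrow> (\<exists>a. (F has_derivative A123_mult a) (at x))" if "x \<in> \<Omega>" for x
  proof -
    have "F differentiable (at x)"
      using assms that by (simp add: differentiable_on_eq_differentiable_at)
    then obtain D where D: "(F has_derivative D) (at x)"
      unfolding differentiable_def ..
    have "(\<forall>i j. i \<noteq> j \<longrightarrow> partial_deriv j (\<lambda>y. F y $ i) x = 0)
        \<longleftrightarrow> (\<exists>a. D = A123_mult a)"
      using linear_eq_A123_mult_iff[OF has_derivative_linear[OF D]]
      by (simp add: partial_deriv_component[OF D])
    \<comment> \<open>The Frechet derivative is unique, so a multiplication is a derivative of \<open>F\<close> only if it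
      is \<open>D\<close> itself.\<close>
    moreover have "D = D' \<longleftrightarrow> (F has_derivative D') (at x)" for D'
      using D has_derivative_unique[OF D, of D'] by (rule_tac iffI) simp_all
    ultimately show ?thesis
      by simp
  qed
  then have "(\<forall>x\<in>\<Omega>. \<forall>i j. i \<noteq> j \<longrightarrow> partial_deriv j (\<lambda>y. F y $ i) x = 0)
      \<longleftrightarrow> algebrizable_on A123_mult F \<Omega>"
    by (simp add: algebrizable_on_iff_has_derivative bounded_linear_A123_mult)
  then show ?thesis
    by blast
qed

end
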